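(* Let $(X,T)$ be a topological dynamical system. For any $\mu\in E(X,T)$ and $\varphi\in C(X,\mathbb{R})$, $$P_{\mathrm{top}}(T,\varphi)=\lim_{\varepsilon\to0}\liminf_{n\to\infty}\frac1n\log\hat S_n(\varphi,\varepsilon)=\lim_{\varepsilon\to0}\limsup_{n\to\infty}\frac1n\log\hat S_n(\varphi,\varepsilon).$$
   Context: A topological dynamical system is a pair $(X,T)$ where $X$ is a compact metric space with metric $d$ and $T:X\to X$ is a homeomorphism. $C(X,\mathbb{R})$ is the set of continuous real-valued functions on $X$; $E(X,T)$ is the set of ergodic $T$-invariant Borel probability measures on $X$ (the measure $\mu$ does not occur in the displayed formula). For integers $n,q\ge1$ put $S_n^q\varphi(x)=\sum_{i=0}^{n-1}\varphi(T^{qi}x)$ and $S_n\varphi=S_n^1\varphi$. Let $d_n(x,y)=\max_{0\le i\le n-1}d(T^ix,T^iy)$; an $(n,\varepsilon)$-spanning set for $X$ is a spanning set in the usual Bowen sense with respect to $d_n$. The topological pressure is $$P_{\mathrm{top}}(T,\varphi)=\lim_{\varepsilon\to0}\limsup_{n\to\infty}\frac1n\log P_n(T,\varphi,\varepsilon),\qquad P_n(T,\varphi,\varepsilon)=\inf\Big\{\sum_{x\in F}e^{S_n\varphi(x)}:F\text{ is an }(n,\varepsilon)\text{-spanning set for }X\Big\}.$$ For $x,y\in X$ put $$\bar d_n^q(x,y)=\frac1n\sum_{i=0}^{n-1}d(T^{qi}x,T^{qi}y),\qquad \hat d_n^q(x,y)=\max\{\bar d_k^q(x,y):1\le k\le n\},$$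 and $B_{\hat d_n^q}(x,\varepsilon)=\{y\in X:\hat d_n^q(x,y)<\varepsilon\}$. For $\varepsilon>0$, $$S_{\hat d_n^q}(\varphi,\varepsilon)=\inf\Big\{\sum_{i=1}^k e^{S_n^q\varphi(x_i)}:\ \bigcup_{i=1}^kB_{\hat d_n^q}(x_i,\varepsilon)=X\Big\},$$ the infimum being over finite collections $x_1,\dots,x_k\in X$, and $$\hat S_n(\varphi,\varepsilon)=\inf_{q\ge1}S_{\hat d_n^q}(\varphi,\varepsilon).$$ *)

theory Defs
  imports "HOL-Probability.Probability"
begin

definition tds :: "'a::metric_space set \<Rightarrow> ('a \<Rightarrow> 'a) \<Rightarrow> bool" where
  "tds X T \<longleftrightarrow> compact X \<and> (\<exists>T'. homeomorphism X X T T')"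

definition ergodic_measures :: "'a::metric_space set \<Rightarrow> ('a \<Rightarrow> 'a) \<Rightarrow> 'a measure set" where
  "ergodic_measures X T = {\<mu>. prob_space \<mu> \<and> sets \<mu> = sets (restrict_space borel X) \<and>
     (\<forall>A\<in>sets \<mu>. measure \<mu> (T -` A \<inter> X) = measure \<mu> A) \<and>
     (\<forall>A\<in>sets \<mu>. T -` A \<inter> X = A \<longrightarrow> measure \<mu> A = 0 \<or> measure \<mu> A = 1)}"

definition birkhoff_sum :: "('a \<Rightarrow> 'a) \<Rightarrow> nat \<Rightarrow> nat \<Rightarrow> ('a \<Rightarrow> real) \<Rightarrow> 'a \<Rightarrow> real" where
  "birkhoff_sum T q n \<phi> x = (\<Sum>i<n. \<phi> ((T ^^ (q * i)) x))"

text \<open>The maximum is over a nonempty set for \<open>n \<ge> 1\<close> only; the value at \<open>n = 0\<close> is irrelevant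
  below, as only limits for \<open>n \<rightarrow> \<infinity>\<close> are taken. The same holds for \<open>max_mean_dist\<close>.\<close>

definition bowen_dist :: "('a::metric_space \<Rightarrow> 'a) \<Rightarrow> nat \<Rightarrow> 'a \<Rightarrow> 'a \<Rightarrow> real" where
  "bowen_dist T n x y = Max ((\<lambda>i. dist ((T ^^ i) x) ((T ^^ i) y)) ` {..<n})"

definition bowen_spanning :: "'a::metric_space set \<Rightarrow> ('a \<Rightarrow> 'a) \<Rightarrow> nat \<Rightarrow> real \<Rightarrow> 'a set \<Rightarrow> bool" where
  "bowen_spanning X T n \<epsilon> F \<longleftrightarrow> F \<subseteq> X \<and> (\<forall>x\<in>X. \<exists>y\<in>F. bowen_dist T n x y \<le> \<epsilon>)"

text \<open>Only finite spanning sets are considered: since \<open>\<phi>\<close> is bounded on \<open>X\<close>, the sum over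
  an infinite one is \<open>\<infinity>\<close> and does not affect the infimum, whereas \<open>sum\<close> would
  return \<open>0\<close>.\<close>

definition pressure_sum ::
    "'a::metric_space set \<Rightarrow> ('a \<Rightarrow> 'a) \<Rightarrow> ('a \<Rightarrow> real) \<Rightarrow> nat \<Rightarrow> real \<Rightarrow> real" where
  "pressure_sum X T \<phi> n \<epsilon> =
     Inf {\<Sum>x\<in>F. exp (birkhoff_sum T 1 n \<phi> x) | F. finite F \<and> bowen_spanning X T n \<epsilon> F}"

text \<open>The pressure can be \<open>\<infinity>\<close>, hence the type \<^typ>\<open>ereal\<close>. That the limit exists
  is shown in \<open>topological_pressure_tendsto\<close> below.\<close>

definition topological_pressure ::
    "'a::metric_space set \<Rightarrow> ('a \<Rightarrow> 'a) \<Rightarrow> ('a \<Rightarrow> real) \<Rightarrow> ereal" where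
  "topological_pressure X T \<phi> =
     Lim (at_right 0) (\<lambda>\<epsilon>. limsup (\<lambda>n. ereal (1 / real n * ln (pressure_sum X T \<phi> n \<epsilon>))))"

definition mean_dist :: "('a::metric_space \<Rightarrow> 'a) \<Rightarrow> nat \<Rightarrow> nat \<Rightarrow> 'a \<Rightarrow> 'a \<Rightarrow> real" where
  "mean_dist T q n x y = 1 / real n * (\<Sum>i<n. dist ((T ^^ (q * i)) x) ((T ^^ (q * i)) y))"

definition max_mean_dist :: "('a::metric_space \<Rightarrow> 'a) \<Rightarrow> nat \<Rightarrow> nat \<Rightarrow> 'a \<Rightarrow> 'a \<Rightarrow> real" where
  "max_mean_dist T q n x y = Max ((\<lambda>k. mean_dist T q k x y) ` {1..n})"

definition max_mean_ball ::
    "'a::metric_space set \<Rightarrow> ('a \<Rightarrow> 'a) \<Rightarrow> nat \<Rightarrow> nat \<Rightarrow> 'a \<Rightarrow> real \<Rightarrow> 'a set" where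
  "max_mean_ball X T q n x \<epsilon> = {y \<in> X. max_mean_dist T q n x y < \<epsilon>}"

definition mean_pressure_sum ::
    "'a::metric_space set \<Rightarrow> ('a \<Rightarrow> 'a) \<Rightarrow> ('a \<Rightarrow> real) \<Rightarrow> nat \<Rightarrow> nat \<Rightarrow> real \<Rightarrow> real" where
  "mean_pressure_sum X T \<phi> q n \<epsilon> =
     Inf {\<Sum>i=1..k. exp (birkhoff_sum T q n \<phi> (x i)) | (x :: nat \<Rightarrow> 'a) k.
            (\<forall>i\<in>{1..k}. x i \<in> X) \<and> (\<Union>i\<in>{1..k}. max_mean_ball X T q n (x i) \<epsilon>) = X}"

definition inf_mean_pressure_sum ::
    "'a::metric_space set \<Rightarrow> ('a \<Rightarrow> 'a) \<Rightarrow> ('a \<Rightarrow> real) \<Rightarrow> nat \<Rightarrow> real \<Rightarrow> real" where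
  "inf_mean_pressure_sum X T \<phi> n \<epsilon> = (INF q\<in>{1..}. mean_pressure_sum X T \<phi> q n \<epsilon>)"

lemma tds_funpow:
  assumes "tds X T"
  shows "continuous_on X (T ^^ i)" "(T ^^ i) ` X \<subseteq> X"
proof -
  have T: "continuous_on X T" "T ` X = X"
    using assms by (auto simp: tds_def homeomorphism_def)
  have "continuous_on X (T ^^ i) \<and> (T ^^ i) ` X \<subseteq> X"
  proof (induction i)
    case (Suc i)
    then have "continuous_on X (T \<circ> (T ^^ i))"
      using T(1) by (meson continuous_on_compose continuous_on_subset)
    then show ?case
      using Suc T(2) by (auto simp: comp_def)
  qed auto
  then show "continuous_on X (T ^^ i)" "(T ^^ i) ` X \<subseteq> X" by auto
qed

lemma finite_bowen_spanning_exists: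
  assumes "tds X T" "0 < n" "0 < \<epsilon>"
  shows "\<exists>F. finite F \<and> bowen_spanning X T n \<epsilon> F"
proof -
  have cpt: "compact X" using assms(1) by (simp add: tds_def)
  have "\<exists>\<delta>>0. \<forall>x\<in>X. \<forall>y\<in>X. dist x y < \<delta> \<longrightarrow> dist ((T ^^ i) x) ((T ^^ i) y) \<le> \<epsilon>" for i
    using compact_uniformly_continuous[OF tds_funpow(1)[OF assms(1), of i] cpt] assms(3)
    unfolding uniformly_continuous_on_def by (meson less_imp_le dist_commute)
  then obtain \<delta> where \<delta>: "\<And>i. \<delta> i > 0"
    "\<And>i x y. x \<in> X \<Longrightarrow> y \<in> X \<Longrightarrow> dist x y < \<delta> i \<Longrightarrow> dist ((T ^^ i) x) ((T ^^ i) y) \<le> \<epsilon>"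
    by metis
  define d where "d = Min (\<delta> ` {..<n})"
  have d: "d > 0" "\<And>i. i < n \<Longrightarrow> d \<le> \<delta> i"
    using \<delta>(1) assms(2) by (auto simp: d_def Min_gr_iff lessThan_empty_iff)
  obtain F where F: "finite F" "F \<subseteq> X" "X \<subseteq> (\<Union>x\<in>F. ball x d)"
    using compactE_image[OF cpt, of X "\<lambda>x. ball x d"] d(1) by force
  have "bowen_spanning X T n \<epsilon> F"
    unfolding bowen_spanning_def
  proof (intro conjI ballI)
    fix x assume x: "x \<in> X"
    then obtain y where y: "y \<in> F" "dist x y < d"
      using F(3) by (auto simp: dist_commute)
    have "dist ((T ^^ i) x) ((T ^^ i) y) \<le> \<epsilon>" if "i < n" for i
      using \<delta>(2)[of x y i] d(2)[OF that] x y F(2) by auto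
    then have "bowen_dist T n x y \<le> \<epsilon>"
      using assms(2) by (auto simp: bowen_dist_def Max_le_iff lessThan_empty_iff)
    then show "\<exists>y\<in>F. bowen_dist T n x y \<le> \<epsilon>" using y by blast
  qed (use F in auto)
  then show ?thesis using F(1) by blast
qed

lemma pressure_sum_antimono:
  assumes "tds X T" "continuous_on X \<phi>" "X \<noteq> {}" "0 < n" "0 < \<epsilon>" "\<epsilon> \<le> \<epsilon>'"
  shows "0 < pressure_sum X T \<phi> n \<epsilon>'" "pressure_sum X T \<phi> n \<epsilon>' \<le> pressure_sum X T \<phi> n \<epsilon>"
proof -
  let ?S = "\<lambda>\<epsilon>. {\<Sum>x\<in>F. exp (birkhoff_sum T 1 n \<phi> x) | F. finite F \<and> bowen_spanning X T n \<epsilon> F}"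
  have ne: "?S \<epsilon> \<noteq> {}" "?S \<epsilon>' \<noteq> {}"
    using finite_bowen_spanning_exists[OF assms(1,4)] assms(5,6) by auto
  have cpt: "compact X" using assms(1) by (simp add: tds_def)
  have "continuous_on X (birkhoff_sum T 1 n \<phi>)"
    unfolding birkhoff_sum_def
    by (intro continuous_intros continuous_on_compose2[OF assms(2)] tds_funpow[OF assms(1)])
  then obtain x0 where x0: "\<And>x. x \<in> X \<Longrightarrow> birkhoff_sum T 1 n \<phi> x0 \<le> birkhoff_sum T 1 n \<phi> x"
    using continuous_attains_inf[OF cpt assms(3)] by blast
  have "exp (birkhoff_sum T 1 n \<phi> x0) \<le> s" if s: "s \<in> ?S \<epsilon>'" for s
  proof -
    obtain F where F: "finite F" "bowen_spanning X T n \<epsilon>' F"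
        "s = (\<Sum>x\<in>F. exp (birkhoff_sum T 1 n \<phi> x))"
      using s by blast
    obtain y where y: "y \<in> F" "y \<in> X"
      using F(2) assms(3) unfolding bowen_spanning_def by blast
    have "exp (birkhoff_sum T 1 n \<phi> x0) \<le> exp (birkhoff_sum T 1 n \<phi> y)"
      using x0 y by simp
    also have "\<dots> \<le> s"
      unfolding F(3) by (rule member_le_sum) (use F y in auto)
    finally show ?thesis .
  qed
  then have "exp (birkhoff_sum T 1 n \<phi> x0) \<le> pressure_sum X T \<phi> n \<epsilon>'"
    unfolding pressure_sum_def by (intro cInf_greatest ne(2)) blast
  then show "0 < pressure_sum X T \<phi> n \<epsilon>'"
    using less_le_trans exp_gt_zero by blast
  have "bdd_below (?S \<epsilon>')"
    by (rule bdd_belowI[of _ 0]) (auto intro: sum_nonneg)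
  moreover have "?S \<epsilon> \<subseteq> ?S \<epsilon>'"
    using assms(6) unfolding bowen_spanning_def by (fastforce intro: order_trans)
  ultimately show "pressure_sum X T \<phi> n \<epsilon>' \<le> pressure_sum X T \<phi> n \<epsilon>"
    unfolding pressure_sum_def by (intro cInf_superset_mono ne)
qed

lemma topological_pressure_tendsto:
  assumes "tds X T" "continuous_on X \<phi>" "X \<noteq> {}"
  shows "((\<lambda>\<epsilon>. limsup (\<lambda>n. ereal (1 / real n * ln (pressure_sum X T \<phi> n \<epsilon>))))
           \<longlongrightarrow> topological_pressure X T \<phi>) (at_right 0)"
proof -
  define f where "f \<epsilon> = limsup (\<lambda>n. ereal (1 / real n * ln (pressure_sum X T \<phi> n \<epsilon>)))" for \<epsilon>
  have anti: "f \<epsilon>' \<le> f \<epsilon>" if "0 < \<epsilon>" "\<epsilon> \<le> \<epsilon>'" for \<epsilon> \<epsilon>'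
    unfolding f_def
  proof (intro Limsup_mono eventually_mono[OF eventually_gt_at_top[of 0]])
    fix n :: nat assume "0 < n"
    then show "ereal (1 / real n * ln (pressure_sum X T \<phi> n \<epsilon>'))
        \<le> ereal (1 / real n * ln (pressure_sum X T \<phi> n \<epsilon>))"
      using pressure_sum_antimono[OF assms, of n \<epsilon> \<epsilon>'] that
      by (simp add: divide_right_mono ln_mono)
  qed
  have "(f \<longlongrightarrow> (SUP \<epsilon>\<in>{0<..}. f \<epsilon>)) (at_right 0)"
  proof (rule order_tendstoI)
    fix a assume "a < (SUP \<epsilon>\<in>{0<..}. f \<epsilon>)"
    then obtain e where e: "e > 0" "a < f e" by (auto simp: less_SUP_iff)
    then have "a < f \<epsilon>" if "\<epsilon> \<in> {0<..<e}" for \<epsilon>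
      using anti[of \<epsilon> e] that by auto
    then show "\<forall>\<^sub>F \<epsilon> in at_right 0. a < f \<epsilon>"
      using e(1) by (intro eventually_at_rightI[of 0 e])
  next
    fix a assume "(SUP \<epsilon>\<in>{0<..}. f \<epsilon>) < a"
    then have "f \<epsilon> < a" if "\<epsilon> \<in> {0<..<1}" for \<epsilon>
      using that SUP_upper[of \<epsilon> "{0<..}" f] by auto
    then show "\<forall>\<^sub>F \<epsilon> in at_right 0. f \<epsilon> < a"
      by (intro eventually_at_rightI[of 0 1]) auto
  qed
  then have "(f \<longlongrightarrow> Lim (at_right 0) f) (at_right 0)"
    using tendsto_Lim[OF trivial_limit_at_right_real] by metis
  then show ?thesis
    unfolding topological_pressure_def f_def .
qed

end

theory Submission
  imports Defs
begin

text \<open>Taking \<open>q = 1\<close> gives the upper bound, since Bowen balls are contained in mean balls. For the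
  lower bound, suppose that for a single pair \<open>n\<close>, \<open>q\<close> the mean balls yield a cover with exponential
  sum below \<open>exp (n * a)\<close>. A \<open>T\<close>-orbit of length \<open>N = M * n * q\<close> splits into \<open>M * q\<close> segments of
  length \<open>n\<close> of \<open>T ^^ q\<close>-orbits, so choosing a ball for each segment gives, for every \<open>M\<close>, a family of
  pseudo-orbits with exponential sum below \<open>exp (N * a)\<close> that shadows every orbit up to a small mean
  error. Correcting the few indices with a large error costs only a factor \<open>exp (N * \<eta>)\<close>, so the
  pressure at any fixed scale is at most \<open>a + \<eta>\<close>, uniformly in \<open>n\<close> and \<open>q\<close>.\<close>

section \<open>Splitting an orbit into blocks along arithmetic progressions\<close>

text \<open>Division with remainder, first by \<open>q\<close> and then by \<open>n\<close>, writes
  each index uniquely as \<open>q * (m * n + t) + s\<close>. For a fixed pair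
  \<open>b = (m, s)\<close> the indices form a progression of step \<open>q\<close>, that is, a
  segment of length \<open>n\<close> of an orbit of \<open>T ^^ q\<close>.\<close>

lemma sum_residue_blocks:
  fixes f :: "nat \<Rightarrow> 'b::comm_monoid_add"
  shows "(\<Sum>i<M * n * q. f i) =
    (\<Sum>b\<in>{..<M} \<times> {..<q}. \<Sum>t<n. f (q * (fst b * n + t) + snd b))"
proof -
  have group: "(\<Sum>i<m * k. g i) = (\<Sum>j<m. \<Sum>s<k. g (j * k + s))" for m k :: nat and g :: "nat \<Rightarrow> 'b"
  proof -
    have "(\<Sum>i<m * k. g i) = (\<Sum>j<m. sum g {j * k..<j * k + k})"
      by (simp add: sum.nat_group)
    also have "\<dots> = (\<Sum>j<m. \<Sum>s<k. g (j * k + s))"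
    proof (rule sum.cong[OF refl])
      fix j
      show "sum g {j * k..<j * k + k} = (\<Sum>s<k. g (j * k + s))"
        by (rule sum.reindex_bij_witness[of _ "\<lambda>s. j * k + s" "\<lambda>i. i - j * k"]) auto
    qed
    finally show ?thesis .
  qed
  have "(\<Sum>i<M * n * q. f i) = (\<Sum>u<M * n. \<Sum>s<q. f (u * q + s))"
    by (rule group)
  also have "\<dots> = (\<Sum>m<M. \<Sum>t<n. \<Sum>s<q. f ((m * n + t) * q + s))"
    by (rule group)
  also have "\<dots> = (\<Sum>m<M. \<Sum>s<q. \<Sum>t<n. f ((m * n + t) * q + s))"
    by (intro sum.cong refl sum.swap)
  also have "\<dots> = (\<Sum>b\<in>{..<M} \<times> {..<q}. \<Sum>t<n. f (q * (fst b * n + t) + snd b))"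
    by (subst sum.cartesian_product) (simp add: case_prod_unfold mult.commute)
  finally show ?thesis .
qed

section \<open>Elementary estimates for Bowen spanning sets and pressure sums\<close>

lemma tds_funpow_in:
  assumes "tds X T" "x \<in> X"
  shows "(T ^^ i) x \<in> X"
  using tds_funpow(2)[OF assms(1)] assms(2) by blast

lemma bowen_dist_le_iff:
  assumes "0 < n"
  shows "bowen_dist T n x y \<le> \<epsilon> \<longleftrightarrow> (\<forall>i<n. dist ((T ^^ i) x) ((T ^^ i) y) \<le> \<epsilon>)"
  using assms by (auto simp: bowen_dist_def Max_le_iff lessThan_empty_iff)

lemma pressure_sum_le:
  assumes "finite F" "bowen_spanning X T n \<epsilon> F"
  shows "pressure_sum X T \<phi> n \<epsilon> \<le> (\<Sum>x\<in>F. exp (birkhoff_sum T 1 n \<phi> x))"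
  unfolding pressure_sum_def using assms
  by (intro cInf_lower bdd_belowI[of _ 0]) (auto intro: sum_nonneg)

text \<open>A set that spans for \<open>N'\<close> also spans for \<open>N\<close>, and each of the
  \<open>N' - N\<close> omitted terms of the Birkhoff sum is at least \<open>- C\<close>. This later
  passes from lengths divisible by \<open>n * q\<close> to arbitrary lengths.\<close>

lemma pressure_sum_mono_length:
  assumes "tds X T" "0 < N" "N \<le> N'" "0 < \<epsilon>" and C: "\<And>x. x \<in> X \<Longrightarrow> \<bar>\<phi> x\<bar> \<le> C"
  shows "pressure_sum X T \<phi> N \<epsilon> \<le> pressure_sum X T \<phi> N' \<epsilon> * exp (C * real (N' - N))"
proof -
  have "pressure_sum X T \<phi> N \<epsilon> / exp (C * real (N' - N)) \<le> pressure_sum X T \<phi> N' \<epsilon>"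
    unfolding pressure_sum_def[of X T \<phi> N']
  proof (rule cInf_greatest)
    show "{\<Sum>x\<in>F. exp (birkhoff_sum T 1 N' \<phi> x) |F. finite F \<and> bowen_spanning X T N' \<epsilon> F} \<noteq> {}"
      using finite_bowen_spanning_exists[OF assms(1) _ assms(4), of N'] assms(2,3) by auto
  next
    fix s assume "s \<in> {\<Sum>x\<in>F. exp (birkhoff_sum T 1 N' \<phi> x) |F. finite F \<and> bowen_spanning X T N' \<epsilon> F}"
    then obtain F where F: "finite F" "bowen_spanning X T N' \<epsilon> F"
      and s: "s = (\<Sum>x\<in>F. exp (birkhoff_sum T 1 N' \<phi> x))" by blast
    have "bowen_spanning X T N \<epsilon> F"
      unfolding bowen_spanning_def
    proof (intro conjI ballI)
      fix x assume "x \<in> X"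
      then obtain y where "y \<in> F" "bowen_dist T N' x y \<le> \<epsilon>"
        using F(2) unfolding bowen_spanning_def by blast
      then show "\<exists>y\<in>F. bowen_dist T N x y \<le> \<epsilon>"
        using assms(2,3) by (intro bexI[of _ y]) (auto simp: bowen_dist_le_iff)
    qed (use F(2) in \<open>auto simp: bowen_spanning_def\<close>)
    then have "pressure_sum X T \<phi> N \<epsilon> \<le> (\<Sum>x\<in>F. exp (birkhoff_sum T 1 N \<phi> x))"
      using F(1) by (intro pressure_sum_le)
    also have "\<dots> \<le> (\<Sum>x\<in>F. exp (birkhoff_sum T 1 N' \<phi> x) * exp (C * real (N' - N)))"
    proof (rule sum_mono)
      fix x assume "x \<in> F"
      then have x: "x \<in> X" using F(2) by (auto simp: bowen_spanning_def)
      have "- (\<Sum>i\<in>{N..<N'}. \<phi> ((T ^^ i) x)) \<le> (\<Sum>i\<in>{N..<N'}. C)"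
        unfolding sum_negf[symmetric]
        by (rule sum_mono) (use C[OF tds_funpow_in[OF assms(1) x]] in \<open>force dest: abs_le_D2\<close>)
      moreover have "birkhoff_sum T 1 N' \<phi> x = birkhoff_sum T 1 N \<phi> x + (\<Sum>i\<in>{N..<N'}. \<phi> ((T ^^ i) x))"
        using assms(3) unfolding birkhoff_sum_def
        by (simp add: lessThan_atLeast0 sum.atLeastLessThan_concat)
      ultimately show "exp (birkhoff_sum T 1 N \<phi> x) \<le> exp (birkhoff_sum T 1 N' \<phi> x) * exp (C * real (N' - N))"
        by (simp add: exp_add[symmetric] mult.commute)
    qed
    also have "\<dots> = s * exp (C * real (N' - N))"
      by (simp add: s sum_distrib_right)
    finally show "pressure_sum X T \<phi> N \<epsilon> / exp (C * real (N' - N)) \<le> s"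
      by (simp add: divide_le_eq)
  qed
  then show ?thesis by (simp add: divide_le_eq)
qed

section \<open>Pressure sums bounded by families of pseudo-orbits\<close>

text \<open>Each index at which the pseudo-orbit is off by at least \<open>\<sigma>\<close> is marked by a point of the
  net \<open>G\<close>. Giving every mark the weight \<open>exp (- L)\<close> bounds the number of possible markings through
  the generating function \<open>(1 + card G * exp (- L)) ^ N\<close>.\<close>

lemma pressure_sum_le_pseudo_orbits:
  fixes X :: "'a::metric_space set" and p :: "'b \<Rightarrow> nat \<Rightarrow> 'a"
  assumes "tds X T" "0 < N" "0 < \<sigma>" "0 \<le> C" "0 \<le> L" "0 \<le> \<eta>"
    and C: "\<And>x. x \<in> X \<Longrightarrow> \<bar>\<phi> x\<bar> \<le> C"
    and osc: "\<And>x y. x \<in> X \<Longrightarrow> y \<in> X \<Longrightarrow> dist x y < \<sigma> \<Longrightarrow> \<bar>\<phi> x - \<phi> y\<bar> \<le> \<eta>"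
    and G: "finite G" "\<And>x. x \<in> X \<Longrightarrow> \<exists>g\<in>G. dist g x < \<sigma>"
    and P: "finite P" "\<And>c i. c \<in> P \<Longrightarrow> i < N \<Longrightarrow> p c i \<in> X"
      "\<And>z. z \<in> X \<Longrightarrow> \<exists>c\<in>P. (\<Sum>i<N. dist (p c i) ((T ^^ i) z)) \<le> real N * \<epsilon>"
  shows "pressure_sum X T \<phi> N (2 * \<sigma>) \<le> (\<Sum>c\<in>P. exp (\<Sum>i<N. \<phi> (p c i)))
    * (1 + real (card G) * exp (- L)) ^ N * exp (real N * (\<eta> + (2 * C + L) * \<epsilon> / \<sigma>))"
proof -
  \<comment> \<open>A marking assigns \<open>None\<close> to an index where the pseudo-orbit is
    within \<sigma> of the orbit, and \<open>Some g\<close> to a bad index, where the orbit is near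
    \<open>g\<close> instead.\<close>
  define H where "H = PiE {..<N} (\<lambda>_. insert None (Some ` G))"
  define b :: "'a option \<Rightarrow> real" where "b a = (if a = None then 0 else 1)" for a
  \<comment> \<open>Exponent of the total error: \<eta> per index, and \<open>2 * C + L\<close> for
    each of the at most \<open>N * \<epsilon> / \<sigma>\<close> bad indices.\<close>
  define K where "K = real N * (\<eta> + (2 * C + L) * \<epsilon> / \<sigma>)"
  define close where "close c h z \<longleftrightarrow> z \<in> X \<and> (\<Sum>i<N. dist (p c i) ((T ^^ i) z)) \<le> real N * \<epsilon>
    \<and> (\<forall>i<N. case h i of None \<Rightarrow> dist (p c i) ((T ^^ i) z) < \<sigma>
      | Some g \<Rightarrow> \<sigma> \<le> dist (p c i) ((T ^^ i) z) \<and> dist g ((T ^^ i) z) < \<sigma>)" for c h z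
  \<comment> \<open>A pseudo-orbit need not be an orbit, but a spanning set consists of points of
    \<open>X\<close>. So only pairs realised by some point are kept, and \<open>pick\<close> selects
    one such point for each.\<close>
  define D where "D = {u \<in> P \<times> H. \<exists>z. close (fst u) (snd u) z}"
  define pick where "pick u = (SOME z. close (fst u) (snd u) z)" for u
  have pick: "close (fst u) (snd u) (pick u)" if "u \<in> D" for u
    using that unfolding D_def pick_def by (auto intro: someI_ex)
  have fin: "finite (P \<times> H)"
    using P(1) G(1) by (auto simp: H_def intro!: finite_PiE)
  then have finD: "finite D" by (auto simp: D_def elim: rev_finite_subset)
  have "bowen_spanning X T N (2 * \<sigma>) (pick ` D)"
    unfolding bowen_spanning_def
  proof (intro conjI ballI)
    show "pick ` D \<subseteq> X" using pick by (auto simp: close_def)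
  next
    fix z assume z: "z \<in> X"
    obtain c where c: "c \<in> P" "(\<Sum>i<N. dist (p c i) ((T ^^ i) z)) \<le> real N * \<epsilon>"
      using P(3)[OF z] by blast
    obtain g where g: "\<And>i. g i \<in> G" "\<And>i. dist (g i) ((T ^^ i) z) < \<sigma>"
      using G(2)[OF tds_funpow_in[OF assms(1) z]] by metis
    define h where "h = (\<lambda>i\<in>{..<N}. if dist (p c i) ((T ^^ i) z) < \<sigma> then None else Some (g i))"
    have "h \<in> H" using g(1) by (auto simp: h_def H_def)
    moreover have cl: "close c h z" using z c g by (auto simp: close_def h_def)
    ultimately have u: "(c, h) \<in> D" using c(1) by (auto simp: D_def)
    \<comment> \<open>Both points realise the same pair \<open>(c, h)\<close>, so at time
      \<open>i\<close> their orbits are within \<sigma> of a common point: \<open>p c i\<close> at a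
      good index, the mark at a bad one.\<close>
    have "dist ((T ^^ i) z) ((T ^^ i) (pick (c, h))) \<le> 2 * \<sigma>" if i: "i < N" for i
    proof -
      obtain a where "dist a ((T ^^ i) z) < \<sigma>" "dist a ((T ^^ i) (pick (c, h))) < \<sigma>"
        using cl pick[OF u] i unfolding close_def fst_conv snd_conv by (cases "h i") fastforce+
      then show ?thesis
        using dist_triangle3[of "(T ^^ i) z" "(T ^^ i) (pick (c, h))" a] by simp
    qed
    then show "\<exists>y\<in>pick ` D. bowen_dist T N z y \<le> 2 * \<sigma>"
      using u assms(2) by (auto simp: bowen_dist_le_iff)
  qed
  then have "pressure_sum X T \<phi> N (2 * \<sigma>) \<le> (\<Sum>x\<in>pick ` D. exp (birkhoff_sum T 1 N \<phi> x))"
    using finD by (intro pressure_sum_le) auto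
  also have "\<dots> \<le> (\<Sum>u\<in>D. exp (birkhoff_sum T 1 N \<phi> (pick u)))"
    using sum_image_le[OF finD, of "\<lambda>x. exp (birkhoff_sum T 1 N \<phi> x)" pick] by (simp add: comp_def)
  also have "\<dots> \<le> (\<Sum>u\<in>D. exp (\<Sum>i<N. \<phi> (p (fst u) i)) * (\<Prod>i<N. exp (- L * b (snd u i))) * exp K)"
  proof (rule sum_mono)
    fix u assume u: "u \<in> D"
    define c h z where "c = fst u" and "h = snd u" and "z = pick u"
    have cl: "close c h z" using pick[OF u] by (simp add: c_def h_def z_def)
    then have z: "z \<in> X" and err: "(\<Sum>i<N. dist (p c i) ((T ^^ i) z)) \<le> real N * \<epsilon>"
      by (auto simp: close_def)
    have cP: "c \<in> P" using u by (auto simp: D_def c_def)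
    \<comment> \<open>At a bad index boundedness replaces continuity: the two values of \<phi>
      differ by at most \<open>2 * C\<close>. The second conjunct prepares the count of bad
      indices.\<close>
    have pt: "\<phi> ((T ^^ i) z) \<le> \<phi> (p c i) + \<eta> + 2 * C * b (h i) \<and> \<sigma> * b (h i) \<le> dist (p c i) ((T ^^ i) z)"
      if i: "i < N" for i
    proof (cases "h i")
      case None
      then have "dist (p c i) ((T ^^ i) z) < \<sigma>" using cl i by (auto simp: close_def split: option.splits)
      then have "\<bar>\<phi> (p c i) - \<phi> ((T ^^ i) z)\<bar> \<le> \<eta>"
        using osc P(2)[OF cP i] tds_funpow_in[OF assms(1) z] by blast
      then show ?thesis using None by (auto simp: b_def)
    next
      case (Some g)
      then have "\<sigma> \<le> dist (p c i) ((T ^^ i) z)" using cl i by (auto simp: close_def split: option.splits)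
      then show ?thesis
        using Some C[OF P(2)[OF cP i]] C[OF tds_funpow_in[OF assms(1) z, of i]] assms(6)
        by (auto simp: b_def)
    qed
    define B where "B = (\<Sum>i<N. b (h i))"
    \<comment> \<open>Markov's inequality: each of the \<open>B\<close> bad indices contributes at
      least \<sigma> to the total error.\<close>
    have "\<sigma> * B \<le> real N * \<epsilon>"
    proof -
      have "\<sigma> * B \<le> (\<Sum>i<N. dist (p c i) ((T ^^ i) z))"
        unfolding B_def sum_distrib_left by (rule sum_mono) (use pt in auto)
      then show ?thesis using err by simp
    qed
    then have "B \<le> real N * \<epsilon> / \<sigma>" using assms(3) by (simp add: field_simps)
    then have "(2 * C + L) * B \<le> (2 * C + L) * (real N * \<epsilon> / \<sigma>)"
      using assms(4,5) by (intro mult_left_mono) auto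
    moreover have "(\<Sum>i<N. \<phi> ((T ^^ i) z)) \<le> (\<Sum>i<N. \<phi> (p c i) + \<eta> + 2 * C * b (h i))"
      by (rule sum_mono) (use pt in auto)
    then have "(\<Sum>i<N. \<phi> ((T ^^ i) z)) \<le> (\<Sum>i<N. \<phi> (p c i)) + real N * \<eta> + 2 * C * B"
      by (simp add: sum.distrib B_def sum_distrib_left)
    \<comment> \<open>The weight of the marking is inserted here; it costs \<open>L * B\<close>, for
      which \<open>K\<close> already contains the allowance.\<close>
    ultimately have "(\<Sum>i<N. \<phi> ((T ^^ i) z)) \<le> (\<Sum>i<N. \<phi> (p c i)) - L * B + K"
      by (simp add: K_def algebra_simps add_divide_distrib)
    then have "exp (\<Sum>i<N. \<phi> ((T ^^ i) z)) \<le> exp ((\<Sum>i<N. \<phi> (p c i)) + (- L * B) + K)"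
      by simp
    also have "\<dots> = exp (\<Sum>i<N. \<phi> (p c i)) * (\<Prod>i<N. exp (- L * b (h i))) * exp K"
      unfolding exp_add B_def sum_distrib_left by (simp add: exp_sum)
    finally show "exp (birkhoff_sum T 1 N \<phi> (pick u))
        \<le> exp (\<Sum>i<N. \<phi> (p (fst u) i)) * (\<Prod>i<N. exp (- L * b (snd u i))) * exp K"
      by (simp add: birkhoff_sum_def c_def h_def z_def)
  qed
  \<comment> \<open>Enlarging \<open>D\<close> to the full product lets the sum factor over
    \<open>P\<close> and \<open>H\<close>.\<close>
  also have "\<dots> \<le> (\<Sum>u\<in>P \<times> H. exp (\<Sum>i<N. \<phi> (p (fst u) i)) * (\<Prod>i<N. exp (- L * b (snd u i))) * exp K)"
    using fin by (intro sum_mono2) (auto simp: D_def intro!: mult_nonneg_nonneg prod_nonneg)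
  also have "\<dots> = (\<Sum>c\<in>P. exp (\<Sum>i<N. \<phi> (p c i))) * (\<Sum>h\<in>H. \<Prod>i<N. exp (- L * b (h i))) * exp K"
    unfolding sum_product unfolding sum_distrib_right unfolding sum.cartesian_product' by simp
  also have "(\<Sum>h\<in>H. \<Prod>i<N. exp (- L * b (h i))) = (1 + real (card G) * exp (- L)) ^ N"
  proof -
    \<comment> \<open>By distributivity the sum over all markings is a product over indices, in
      which \<open>None\<close> contributes 1 and each point of \<open>G\<close> contributes
      \<open>exp (- L)\<close>.\<close>
    have "(\<Sum>h\<in>H. \<Prod>i<N. exp (- L * b (h i)))
        = (\<Prod>i<N. \<Sum>a\<in>insert None (Some ` G). exp (- L * b a))"
      unfolding H_def using G(1) by (intro prod_sum_PiE[symmetric]) auto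
    also have "(\<Sum>a\<in>insert None (Some ` G). exp (- L * b a)) = 1 + real (card G) * exp (- L)"
      using G(1) by (subst sum.insert) (auto simp: sum.reindex b_def)
    finally show ?thesis by simp
  qed
  finally show ?thesis by (simp add: K_def)
qed

section \<open>From one mean cover to pressure sums of long orbits\<close>

lemma max_mean_dist_ge_mean_dist:
  assumes "0 < n"
  shows "mean_dist T q n x y \<le> max_mean_dist T q n x y"
  unfolding max_mean_dist_def using assms by (intro Max_ge) auto

text \<open>Choosing one ball for each of the \<open>M * q\<close> segments defines a pseudo-orbit,
  and some choice follows any given orbit in the mean. The choices are independent, so their
  exponential sum is the corresponding power of the sum of the cover.\<close>

lemma pressure_sum_le_mean_cover:
  fixes X :: "'a::metric_space set" and x :: "nat \<Rightarrow> 'a"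
  assumes "tds X T" "0 < M" "0 < n" "0 < q" "0 < \<sigma>" "0 \<le> C" "0 \<le> L" "0 \<le> \<eta>"
    and C: "\<And>x. x \<in> X \<Longrightarrow> \<bar>\<phi> x\<bar> \<le> C"
    and osc: "\<And>x y. x \<in> X \<Longrightarrow> y \<in> X \<Longrightarrow> dist x y < \<sigma> \<Longrightarrow> \<bar>\<phi> x - \<phi> y\<bar> \<le> \<eta>"
    and G: "finite G" "\<And>x. x \<in> X \<Longrightarrow> \<exists>g\<in>G. dist g x < \<sigma>"
    and x: "\<And>j. j \<in> {1..k} \<Longrightarrow> x j \<in> X" "(\<Union>j\<in>{1..k}. max_mean_ball X T q n (x j) \<epsilon>) = X"
  shows "pressure_sum X T \<phi> (M * n * q) (2 * \<sigma>)
    \<le> (\<Sum>j=1..k. exp (birkhoff_sum T q n \<phi> (x j))) ^ (M * q)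
      * (1 + real (card G) * exp (- L)) ^ (M * n * q)
      * exp (real (M * n * q) * (\<eta> + (2 * C + L) * \<epsilon> / \<sigma>))"
proof -
  define J where "J = {..<M} \<times> {..<q}"
  define P where "P = PiE J (\<lambda>_. {1..k})"
  \<comment> \<open>This inverts the index decomposition: \<open>i\<close> is read as block
    \<open>(m, s)\<close> and time \<open>t\<close>, and the value is the point at time
    \<open>t\<close> of the \<open>T ^^ q\<close>-orbit of the chosen centre.\<close>
  define p where "p c i = (T ^^ (q * ((i div q) mod n))) (x (c ((i div q) div n, i mod q)))"
    for c :: "nat \<times> nat \<Rightarrow> nat" and i
  have p: "p c (q * (fst b * n + t) + snd b) = (T ^^ (q * t)) (x (c b))"
    if "b \<in> J" "t < n" for c b t
  proof -
    have s: "snd b < q" using that by (auto simp: J_def)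
    have "(q * (fst b * n + t) + snd b) div q = fst b * n + t" "(q * (fst b * n + t) + snd b) mod q = snd b"
      using s by auto
    then show ?thesis using that(2) by (simp add: p_def)
  qed
  have "pressure_sum X T \<phi> (M * n * q) (2 * \<sigma>) \<le> (\<Sum>c\<in>P. exp (\<Sum>i<M * n * q. \<phi> (p c i)))
    * (1 + real (card G) * exp (- L)) ^ (M * n * q) * exp (real (M * n * q) * (\<eta> + (2 * C + L) * \<epsilon> / \<sigma>))"
  proof (rule pressure_sum_le_pseudo_orbits[OF assms(1) _ assms(5-8) C osc G])
    show "0 < M * n * q" using assms by simp
    show "finite P" by (auto simp: P_def J_def intro!: finite_PiE)
  next
    fix c i assume c: "c \<in> P" and i: "i < M * n * q"
    have "i div q < M * n" using i by (simp add: less_mult_imp_div_less)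
    then have "i div q div n < M" by (simp add: less_mult_imp_div_less)
    then have "(i div q div n, i mod q) \<in> J" using assms(4) by (auto simp: J_def)
    then have "c (i div q div n, i mod q) \<in> {1..k}" using c unfolding P_def by (rule PiE_mem[rotated])
    then show "p c i \<in> X" unfolding p_def by (intro tds_funpow_in[OF assms(1)] x(1))
  next
    fix z assume z: "z \<in> X"
    \<comment> \<open>The starting point of segment \<open>b\<close> of the orbit of
      \<open>z\<close>.\<close>
    define y where "y b = (T ^^ (q * (fst b * n) + snd b)) z" for b
    have "\<exists>j\<in>{1..k}. y b \<in> max_mean_ball X T q n (x j) \<epsilon>" for b
      using x(2) tds_funpow_in[OF assms(1) z] unfolding y_def by blast
    then obtain c' where c': "\<And>b. c' b \<in> {1..k}" "\<And>b. y b \<in> max_mean_ball X T q n (x (c' b)) \<epsilon>"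
      by metis
    define c where "c = restrict c' J"
    have "(\<Sum>t<n. dist ((T ^^ (q * t)) (x (c b))) ((T ^^ (q * t)) (y b))) \<le> real n * \<epsilon>" if b: "b \<in> J" for b
    proof -
      have "mean_dist T q n (x (c b)) (y b) < \<epsilon>"
        using c'(2)[of b] max_mean_dist_ge_mean_dist[OF assms(3), of T q "x (c' b)" "y b"] b
        by (auto simp: max_mean_ball_def c_def)
      then show ?thesis using assms(3) by (simp add: mean_dist_def field_simps)
    qed
    then have "(\<Sum>b\<in>J. \<Sum>t<n. dist ((T ^^ (q * t)) (x (c b))) ((T ^^ (q * t)) (y b))) \<le> (\<Sum>b\<in>J. real n * \<epsilon>)"
      by (rule sum_mono)
    also have "(\<Sum>b\<in>J. real n * \<epsilon>) = real (M * n * q) * \<epsilon>"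
      by (simp add: J_def)
    also have "(\<Sum>b\<in>J. \<Sum>t<n. dist ((T ^^ (q * t)) (x (c b))) ((T ^^ (q * t)) (y b)))
        = (\<Sum>i<M * n * q. dist (p c i) ((T ^^ i) z))"
      unfolding sum_residue_blocks J_def[symmetric]
    proof (intro sum.cong refl)
      fix b t assume "b \<in> J" "t \<in> {..<n}"
      moreover have "(T ^^ (q * (fst b * n + t) + snd b)) z = (T ^^ (q * t)) (y b)"
        unfolding y_def funpow_add[symmetric, THEN fun_cong, unfolded comp_def]
        by (simp add: algebra_simps)
      ultimately show "dist ((T ^^ (q * t)) (x (c b))) ((T ^^ (q * t)) (y b)) =
        dist (p c (q * (fst b * n + t) + snd b)) ((T ^^ (q * (fst b * n + t) + snd b)) z)"
        by (simp only: p lessThan_iff)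
    qed
    finally have "(\<Sum>i<M * n * q. dist (p c i) ((T ^^ i) z)) \<le> real (M * n * q) * \<epsilon>" .
    moreover have "c \<in> P" using c'(1) by (auto simp: c_def P_def)
    ultimately show "\<exists>c\<in>P. (\<Sum>i<M * n * q. dist (p c i) ((T ^^ i) z)) \<le> real (M * n * q) * \<epsilon>" by blast
  qed
  also have "(\<Sum>c\<in>P. exp (\<Sum>i<M * n * q. \<phi> (p c i)))
      = (\<Sum>j=1..k. exp (birkhoff_sum T q n \<phi> (x j))) ^ (M * q)"
  proof -
    \<comment> \<open>The sum along a pseudo-orbit splits into Birkhoff sums of the centres, so the
      exponentials multiply over \<open>J\<close> and the sum over \<open>c\<close> is an expanded
      product of sums.\<close>
    have "(\<Sum>i<M * n * q. \<phi> (p c i)) = (\<Sum>b\<in>J. birkhoff_sum T q n \<phi> (x (c b)))" for c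
      unfolding sum_residue_blocks J_def[symmetric] birkhoff_sum_def
      by (intro sum.cong refl) (simp only: p lessThan_iff)
    then have "(\<Sum>c\<in>P. exp (\<Sum>i<M * n * q. \<phi> (p c i)))
        = (\<Sum>c\<in>P. \<Prod>b\<in>J. exp (birkhoff_sum T q n \<phi> (x (c b))))"
      by (simp add: exp_sum J_def)
    also have "\<dots> = (\<Prod>b\<in>J. \<Sum>j=1..k. exp (birkhoff_sum T q n \<phi> (x j)))"
      unfolding P_def by (intro prod_sum_PiE[symmetric]) (auto simp: J_def)
    also have "\<dots> = (\<Sum>j=1..k. exp (birkhoff_sum T q n \<phi> (x j))) ^ (M * q)"
      by (simp add: J_def)
    finally show ?thesis .
  qed
  finally show ?thesis .
qed

section \<open>Mean covers from Bowen spanning sets, and bounds uniform in \<open>q\<close>\<close>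

text \<open>The times \<open>q * i\<close> with \<open>i < k \<le> n\<close> lie below
  \<open>n * q\<close>, so every mean averages distances of at most \<open>\<epsilon> / 2\<close>.
  The halving makes the conclusion strict.\<close>

lemma max_mean_dist_less_of_bowen_dist:
  assumes "0 < n" "0 < q" "0 < \<epsilon>" "bowen_dist T (n * q) x y \<le> \<epsilon> / 2"
  shows "max_mean_dist T q n x y < \<epsilon>"
proof -
  have "mean_dist T q k x y < \<epsilon>" if k: "k \<in> {1..n}" for k
  proof -
    have "(\<Sum>i<k. dist ((T ^^ (q * i)) x) ((T ^^ (q * i)) y)) \<le> (\<Sum>i<k. \<epsilon> / 2)"
    proof (rule sum_mono)
      fix i assume "i \<in> {..<k}"
      then have "q * i < n * q" using k assms(2) by (simp add: mult.commute)
      then show "dist ((T ^^ (q * i)) x) ((T ^^ (q * i)) y) \<le> \<epsilon> / 2"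
        using assms(4) bowen_dist_le_iff[of "n * q" T x y "\<epsilon> / 2"] assms(1,2) by auto
    qed
    then have "mean_dist T q k x y \<le> \<epsilon> / 2"
      using k by (simp add: mean_dist_def field_simps)
    then show ?thesis using assms(3) by simp
  qed
  then show ?thesis using assms(1) by (auto simp: max_mean_dist_def Max_less_iff)
qed

text \<open>A bijective enumeration of \<open>F\<close> turns the sum over a set into an indexed
  sum. This yields the existence of covers and, for \<open>q = 1\<close>, the comparison with
  \<open>pressure_sum\<close>.\<close>

lemma bowen_spanning_imp_mean_cover:
  assumes "0 < n" "0 < q" "0 < \<epsilon>" "finite F" "bowen_spanning X T (n * q) (\<epsilon> / 2) F"
  obtains x :: "nat \<Rightarrow> 'a::metric_space" and k where "\<forall>i\<in>{1..k}. x i \<in> X"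
    "(\<Union>i\<in>{1..k}. max_mean_ball X T q n (x i) \<epsilon>) = X"
    "(\<Sum>i=1..k. exp (birkhoff_sum T q n \<phi> (x i))) = (\<Sum>x\<in>F. exp (birkhoff_sum T q n \<phi> x))"
proof -
  obtain h where h: "bij_betw h {1..card F} F"
    using ex_bij_betw_nat_finite_1[OF assms(4)] by blast
  then have img: "h ` {1..card F} = F" by (simp add: bij_betw_def)
  have "X \<subseteq> (\<Union>y\<in>F. max_mean_ball X T q n y \<epsilon>)"
  proof
    fix x assume x: "x \<in> X"
    then obtain y where y: "y \<in> F" "bowen_dist T (n * q) x y \<le> \<epsilon> / 2"
      using assms(5) unfolding bowen_spanning_def by blast
    then have "bowen_dist T (n * q) y x \<le> \<epsilon> / 2"
      using assms(1,2) bowen_dist_le_iff[of "n * q" T x y "\<epsilon> / 2"]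
        bowen_dist_le_iff[of "n * q" T y x "\<epsilon> / 2"] by (simp add: dist_commute)
    then show "x \<in> (\<Union>y\<in>F. max_mean_ball X T q n y \<epsilon>)"
      using x y(1) max_mean_dist_less_of_bowen_dist[OF assms(1-3)] by (auto simp: max_mean_ball_def)
  qed
  then have "(\<Union>y\<in>F. max_mean_ball X T q n y \<epsilon>) = X" by (auto simp: max_mean_ball_def)
  moreover have "(\<Union>i\<in>{1..card F}. max_mean_ball X T q n (h i) \<epsilon>)
      = (\<Union>y\<in>h ` {1..card F}. max_mean_ball X T q n y \<epsilon>)"
    by simp
  ultimately have "(\<Union>i\<in>{1..card F}. max_mean_ball X T q n (h i) \<epsilon>) = X"
    unfolding img by simp
  moreover have "\<forall>i\<in>{1..card F}. h i \<in> X"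
    using img assms(5) unfolding bowen_spanning_def by blast
  ultimately show ?thesis
    using sum.reindex_bij_betw[OF h, of "\<lambda>x. exp (birkhoff_sum T q n \<phi> x)"] that by blast
qed

lemma mean_pressure_sum_le:
  fixes x :: "nat \<Rightarrow> 'a::metric_space"
  assumes "\<forall>i\<in>{1..k}. x i \<in> X" "(\<Union>i\<in>{1..k}. max_mean_ball X T q n (x i) \<epsilon>) = X"
  shows "mean_pressure_sum X T \<phi> q n \<epsilon> \<le> (\<Sum>i=1..k. exp (birkhoff_sum T q n \<phi> (x i)))"
  unfolding mean_pressure_sum_def
proof (rule cInf_lower)
  show "bdd_below {\<Sum>i=1..k. exp (birkhoff_sum T q n \<phi> (x i)) | x k.
      (\<forall>i\<in>{1..k}. x i \<in> X) \<and> (\<Union>i\<in>{1..k}. max_mean_ball X T q n (x i) \<epsilon>) = X}"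
    by (intro bdd_belowI[of _ 0]) (auto intro!: sum_nonneg)
qed (intro CollectI exI[of _ x] exI[of _ k] conjI refl assms)

text \<open>A real \<open>Inf\<close> is approximated by members only of a nonempty set; a finite
  Bowen spanning set of length \<open>n * q\<close> supplies a member.\<close>

lemma mean_pressure_sum_lessE:
  fixes X :: "'a::metric_space set"
  assumes "tds X T" "0 < n" "0 < q" "0 < \<epsilon>" "mean_pressure_sum X T \<phi> q n \<epsilon> < a"
  obtains x :: "nat \<Rightarrow> 'a" and k where "\<forall>i\<in>{1..k}. x i \<in> X"
    "(\<Union>i\<in>{1..k}. max_mean_ball X T q n (x i) \<epsilon>) = X"
    "(\<Sum>i=1..k. exp (birkhoff_sum T q n \<phi> (x i))) < a"
proof -
  let ?S = "{\<Sum>i=1..k. exp (birkhoff_sum T q n \<phi> (x i)) | (x :: nat \<Rightarrow> 'a) k.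
    (\<forall>i\<in>{1..k}. x i \<in> X) \<and> (\<Union>i\<in>{1..k}. max_mean_ball X T q n (x i) \<epsilon>) = X}"
  obtain F where F: "finite F" "bowen_spanning X T (n * q) (\<epsilon> / 2) F"
    using finite_bowen_spanning_exists[OF assms(1), of "n * q" "\<epsilon> / 2"] assms(2-4) by auto
  obtain x :: "nat \<Rightarrow> 'a" and k where "\<forall>i\<in>{1..k}. x i \<in> X"
    "(\<Union>i\<in>{1..k}. max_mean_ball X T q n (x i) \<epsilon>) = X"
    using bowen_spanning_imp_mean_cover[OF assms(2-4) F] by metis
  then have "?S \<noteq> {}" by blast
  then obtain s where "s \<in> ?S" "s < a"
    using cInf_lessD[of ?S a] assms(5) unfolding mean_pressure_sum_def by blast
  then show ?thesis using that by blast
qed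

text \<open>As \<open>X\<close> is nonempty, every cover has a centre, and its term alone reaches
  the bound. The bound is free of \<open>q\<close>, so the infimum over \<open>q\<close> is bounded
  below and positive, and its \<open>ln\<close> is meaningful.\<close>

lemma mean_pressure_sum_ge:
  fixes X :: "'a::metric_space set"
  assumes "tds X T" "X \<noteq> {}" "0 < n" "0 < q" "0 < \<epsilon>" and C: "\<And>x. x \<in> X \<Longrightarrow> \<bar>\<phi> x\<bar> \<le> C"
  shows "exp (- (real n * C)) \<le> mean_pressure_sum X T \<phi> q n \<epsilon>"
proof (rule ccontr)
  assume "\<not> ?thesis"
  then have "mean_pressure_sum X T \<phi> q n \<epsilon> < exp (- (real n * C))" by simp
  then obtain x :: "nat \<Rightarrow> 'a" and k where x: "\<forall>i\<in>{1..k}. x i \<in> X"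
    "(\<Union>i\<in>{1..k}. max_mean_ball X T q n (x i) \<epsilon>) = X"
    "(\<Sum>i=1..k. exp (birkhoff_sum T q n \<phi> (x i))) < exp (- (real n * C))"
    by (rule mean_pressure_sum_lessE[OF assms(1,3-5)])
  obtain i where i: "i \<in> {1..k}" using x(2) assms(2) by blast
  have "(\<Sum>j<n. - C) \<le> birkhoff_sum T q n \<phi> (x i)"
    unfolding birkhoff_sum_def
  proof (rule sum_mono)
    fix j
    show "- C \<le> \<phi> ((T ^^ (q * j)) (x i))"
      using C[OF tds_funpow_in[OF assms(1)], of "x i" "q * j"] x(1) i by fastforce
  qed
  then have "exp (- (real n * C)) \<le> exp (birkhoff_sum T q n \<phi> (x i))" by simp
  also have "\<dots> \<le> (\<Sum>i=1..k. exp (birkhoff_sum T q n \<phi> (x i)))"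
    using i by (intro member_le_sum) auto
  finally show False using x(3) by simp
qed

lemma inf_mean_pressure_sum_ge:
  assumes "tds X T" "X \<noteq> {}" "0 < n" "0 < \<epsilon>" "\<And>x. x \<in> X \<Longrightarrow> \<bar>\<phi> x\<bar> \<le> C"
  shows "exp (- (real n * C)) \<le> inf_mean_pressure_sum X T \<phi> n \<epsilon>"
  unfolding inf_mean_pressure_sum_def
  using mean_pressure_sum_ge[OF assms(1-3) _ assms(4), of _ \<phi> C] assms(5)
  by (intro cINF_greatest) auto

lemma inf_mean_pressure_sum_le_pressure_sum:
  fixes X :: "'a::metric_space set"
  assumes "tds X T" "X \<noteq> {}" "0 < n" "0 < \<epsilon>" "\<And>x. x \<in> X \<Longrightarrow> \<bar>\<phi> x\<bar> \<le> C"
  shows "inf_mean_pressure_sum X T \<phi> n \<epsilon> \<le> pressure_sum X T \<phi> n (\<epsilon> / 2)"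
proof -
  have "inf_mean_pressure_sum X T \<phi> n \<epsilon> \<le> mean_pressure_sum X T \<phi> 1 n \<epsilon>"
    unfolding inf_mean_pressure_sum_def
    using mean_pressure_sum_ge[OF assms(1-3) _ assms(4), of _ \<phi> C] assms(5)
    by (intro cINF_lower bdd_belowI[of _ "exp (- (real n * C))"]) auto
  also have "\<dots> \<le> pressure_sum X T \<phi> n (\<epsilon> / 2)"
    unfolding pressure_sum_def
  proof (rule cInf_greatest)
    show "{\<Sum>x\<in>F. exp (birkhoff_sum T 1 n \<phi> x) |F. finite F \<and> bowen_spanning X T n (\<epsilon> / 2) F} \<noteq> {}"
      using finite_bowen_spanning_exists[OF assms(1,3), of "\<epsilon> / 2"] assms(4) by auto
  next
    fix s assume "s \<in> {\<Sum>x\<in>F. exp (birkhoff_sum T 1 n \<phi> x) |F. finite F \<and> bowen_spanning X T n (\<epsilon> / 2) F}"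
    then obtain F where F: "finite F" "bowen_spanning X T (n * 1) (\<epsilon> / 2) F"
      and s: "s = (\<Sum>x\<in>F. exp (birkhoff_sum T 1 n \<phi> x))" by auto
    obtain x :: "nat \<Rightarrow> 'a" and k where "\<forall>i\<in>{1..k}. x i \<in> X"
      "(\<Union>i\<in>{1..k}. max_mean_ball X T 1 n (x i) \<epsilon>) = X"
      "(\<Sum>i=1..k. exp (birkhoff_sum T 1 n \<phi> (x i))) = (\<Sum>x\<in>F. exp (birkhoff_sum T 1 n \<phi> x))"
      using bowen_spanning_imp_mean_cover[OF assms(3) zero_less_one assms(4) F] by metis
    then show "mean_pressure_sum X T \<phi> 1 n \<epsilon> \<le> s"
      using mean_pressure_sum_le s by metis
  qed
  finally show ?thesis .
qed

section \<open>The lower bound, uniform in \<open>n\<close> and \<open>q\<close>\<close>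

text \<open>The threshold \<open>\<epsilon>\<^sub>0\<close> is fixed before \<open>n\<close> and
  \<open>q\<close>. If the bound failed for one \<open>n\<close>, a single \<open>q\<close> and a
  single cover would already force the growth rate at scale \<delta> down to
  \<open>r - \<eta> / 4\<close>.\<close>

lemma exp_le_inf_mean_pressure_sum:
  fixes X :: "'a::metric_space set"
  assumes "tds X T" "continuous_on X \<phi>" "X \<noteq> {}" "0 < \<delta>" "0 < \<eta>"
    and r: "ereal r < limsup (\<lambda>n. ereal (1 / real n * ln (pressure_sum X T \<phi> n \<delta>)))"
  obtains \<epsilon>\<^sub>0 where "0 < \<epsilon>\<^sub>0"
    "\<And>\<epsilon> n. 0 < \<epsilon> \<Longrightarrow> \<epsilon> < \<epsilon>\<^sub>0 \<Longrightarrow> 0 < n \<Longrightarrow> exp (real n * (r - \<eta>)) \<le> inf_mean_pressure_sum X T \<phi> n \<epsilon>"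
proof -
  have cpt: "compact X" using assms(1) by (simp add: tds_def)
  obtain C where C: "\<And>x. x \<in> X \<Longrightarrow> \<bar>\<phi> x\<bar> \<le> C"
    using compact_imp_bounded[OF compact_continuous_image[OF assms(2) cpt]]
    by (auto simp: bounded_iff)
  then have C0: "0 \<le> C" using assms(3) by force
  obtain \<sigma>' where \<sigma>': "0 < \<sigma>'"
    "\<And>x y. x \<in> X \<Longrightarrow> y \<in> X \<Longrightarrow> dist x y < \<sigma>' \<Longrightarrow> \<bar>\<phi> x - \<phi> y\<bar> < \<eta> / 4"
    using compact_uniformly_continuous[OF assms(2) cpt] assms(5)
    unfolding uniformly_continuous_on_def dist_real_def
    by (metis zero_less_divide_iff zero_less_numeral)
  \<comment> \<open>Besides controlling the oscillation of \<phi>, \<sigma> must satisfy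
    \<open>2 * \<sigma> \<le> \<delta>\<close>, because the pseudo-orbit estimate holds at scale
    \<open>2 * \<sigma>\<close>.\<close>
  define \<sigma> where "\<sigma> = min \<sigma>' (\<delta> / 2)"
  have \<sigma>: "0 < \<sigma>" "2 * \<sigma> \<le> \<delta>"
    and osc: "\<And>x y. x \<in> X \<Longrightarrow> y \<in> X \<Longrightarrow> dist x y < \<sigma> \<Longrightarrow> \<bar>\<phi> x - \<phi> y\<bar> \<le> \<eta> / 4"
    using \<sigma>' assms(4) by (auto simp: \<sigma>_def intro: less_imp_le)
  obtain G where G: "finite G" "G \<subseteq> X" "X \<subseteq> (\<Union>x\<in>G. ball x \<sigma>)"
    using compactE_image[OF cpt, of X "\<lambda>x. ball x \<sigma>"] \<sigma>(1) by force
  have net: "\<exists>g\<in>G. dist g x < \<sigma>" if "x \<in> X" for x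
    using G(3) that unfolding mem_ball[symmetric] by blast
  \<comment> \<open>Large enough that marking costs at most a factor \<open>exp (\<eta> / 4)\<close>
    per index.\<close>
  define L where "L = max 0 (- ln (\<eta> / (4 * (real (card G) + 1))))"
  have L: "0 \<le> L" "real (card G) * exp (- L) \<le> \<eta> / 4"
  proof -
    have "exp (- L) \<le> exp (ln (\<eta> / (4 * (real (card G) + 1))))"
      by (simp add: L_def)
    also have "\<dots> = \<eta> / (4 * (real (card G) + 1))"
      using assms(5) by (intro exp_ln divide_pos_pos) auto
    finally have "(real (card G) + 1) * exp (- L) \<le> \<eta> / 4"
      by (simp add: field_simps)
    then show "real (card G) * exp (- L) \<le> \<eta> / 4"
      using exp_gt_zero[of "- L"] by (simp only: distrib_right)
  qed (simp add: L_def)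
  \<comment> \<open>Chosen so that bad indices cost at most \<open>\<eta> / 4\<close> per index; the
    \<open>+ 1\<close> keeps the denominator positive when \<open>C = L = 0\<close>.\<close>
  define \<epsilon>\<^sub>0 where "\<epsilon>\<^sub>0 = \<eta> * \<sigma> / (4 * (2 * C + L + 1))"
  have "0 < \<epsilon>\<^sub>0" using assms(5) \<sigma> C0 L by (simp add: \<epsilon>\<^sub>0_def)
  moreover have "exp (real n * (r - \<eta>)) \<le> inf_mean_pressure_sum X T \<phi> n \<epsilon>"
    if \<epsilon>: "0 < \<epsilon>" "\<epsilon> < \<epsilon>\<^sub>0" and n: "0 < n" for \<epsilon> n
  proof (rule ccontr)
    assume "\<not> ?thesis"
    then have "(INF q\<in>{1..}. mean_pressure_sum X T \<phi> q n \<epsilon>) < exp (real n * (r - \<eta>))"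
      by (simp add: inf_mean_pressure_sum_def)
    then obtain q where q: "0 < q" "mean_pressure_sum X T \<phi> q n \<epsilon> < exp (real n * (r - \<eta>))"
      using cInf_lessD[of "(\<lambda>q. mean_pressure_sum X T \<phi> q n \<epsilon>) ` {1..}" "exp (real n * (r - \<eta>))"]
      by (auto simp: Suc_le_eq)
    obtain x :: "nat \<Rightarrow> 'a" and k where x: "\<forall>i\<in>{1..k}. x i \<in> X"
      "(\<Union>i\<in>{1..k}. max_mean_ball X T q n (x i) \<epsilon>) = X"
      "(\<Sum>i=1..k. exp (birkhoff_sum T q n \<phi> (x i))) < exp (real n * (r - \<eta>))"
      by (rule mean_pressure_sum_lessE[OF assms(1) n q(1) \<epsilon>(1) q(2)])
    define A where "A = (\<Sum>i=1..k. exp (birkhoff_sum T q n \<phi> (x i)))"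
    have A: "0 \<le> A" by (auto simp: A_def intro!: sum_nonneg)
    \<comment> \<open>The rate \<open>r - \<eta>\<close> of the cover plus three errors of
      \<open>\<eta> / 4\<close>: markings, oscillation of \<phi> and bad indices.\<close>
    define r' where "r' = r - \<eta> / 4"
    have block: "pressure_sum X T \<phi> (M * n * q) \<delta> \<le> exp (real (M * n * q) * r')" if M: "0 < M" for M
    proof -
      define N where "N = M * n * q"
      have N: "0 < N" using M n q by (simp add: N_def)
      have "pressure_sum X T \<phi> N \<delta> \<le> pressure_sum X T \<phi> N (2 * \<sigma>)"
        using pressure_sum_antimono(2)[OF assms(1-3) N _ \<sigma>(2)] \<sigma>(1) by simp
      also have "\<dots> \<le> A ^ (M * q) * (1 + real (card G) * exp (- L)) ^ N
          * exp (real N * (\<eta> / 4 + (2 * C + L) * \<epsilon> / \<sigma>))"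
        unfolding A_def N_def
        using pressure_sum_le_mean_cover[OF assms(1) M n q(1) \<sigma>(1) C0 L(1) _ C osc G(1) net _ x(2)]
          x(1) assms(5) by simp
      also have "\<dots> \<le> exp (real N * (r - \<eta>)) * exp (real N * (\<eta> / 4)) * exp (real N * (\<eta> / 4 + \<eta> / 4))"
      proof (intro mult_mono)
        have "A ^ (M * q) \<le> exp (real n * (r - \<eta>)) ^ (M * q)"
          using x(3) A by (intro power_mono) (auto simp: A_def)
        also have "\<dots> = exp (real N * (r - \<eta>))"
          by (simp add: N_def exp_of_nat_mult[symmetric] algebra_simps)
        finally show "A ^ (M * q) \<le> exp (real N * (r - \<eta>))" .
        have "1 + real (card G) * exp (- L) \<le> exp (\<eta> / 4)"
          using L(2) exp_ge_add_one_self[of "\<eta> / 4"] by linarith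
        then have "(1 + real (card G) * exp (- L)) ^ N \<le> exp (\<eta> / 4) ^ N"
          by (intro power_mono) auto
        then show "(1 + real (card G) * exp (- L)) ^ N \<le> exp (real N * (\<eta> / 4))"
          by (simp add: exp_of_nat_mult[symmetric])
        have "(2 * C + L) * \<epsilon> \<le> (2 * C + L + 1) * \<epsilon>\<^sub>0"
          using \<epsilon> C0 L(1) by (intro mult_mono) auto
        also have "\<dots> = \<eta> / 4 * \<sigma>"
          using C0 L(1) by (simp add: \<epsilon>\<^sub>0_def field_simps)
        finally have "(2 * C + L) * \<epsilon> / \<sigma> \<le> \<eta> / 4"
          using \<sigma>(1) by (simp add: pos_divide_le_eq)
        then show "exp (real N * (\<eta> / 4 + (2 * C + L) * \<epsilon> / \<sigma>)) \<le> exp (real N * (\<eta> / 4 + \<eta> / 4))"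
          unfolding exp_le_cancel_iff by (intro mult_left_mono add_left_mono) auto
      qed (use A in auto)
      also have "\<dots> = exp (real N * r')"
        by (simp add: exp_add[symmetric] r'_def algebra_simps)
      finally show ?thesis by (simp add: N_def)
    qed
    \<comment> \<open>Cost of rounding a length up to a multiple of \<open>n * q\<close>. It does
      not depend on \<open>N\<close>, so \<open>D / N\<close> vanishes in the limit.\<close>
    define D where "D = real (n * q) * (\<bar>r'\<bar> + C)"
    have "1 / real N * ln (pressure_sum X T \<phi> N \<delta>) \<le> r' + D / real N" if N: "0 < N" for N
    proof -
      \<comment> \<open>The \<open>+ 1\<close> gives both \<open>0 < M\<close>, as
        \<open>block\<close> demands, and \<open>N \<le> M * n * q\<close>, with an excess of at
        most \<open>n * q\<close>.\<close>
      define M where "M = N div (n * q) + 1"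
      have nq: "0 < n * q" using n q by simp
      have "N = (M - 1) * (n * q) + N mod (n * q)"
        by (simp only: M_def diff_add_inverse2 div_mult_mod_eq)
      moreover have "N mod (n * q) < n * q" using nq by simp
      moreover have "M * (n * q) = (M - 1) * (n * q) + n * q" by (simp add: M_def)
      ultimately have M: "N \<le> M * n * q" "M * n * q - N \<le> n * q"
        unfolding mult.assoc by linarith+
      define d where "d = M * n * q - N"
      have d: "real (M * n * q) = real N + real d" "d \<le> n * q" using M by (auto simp: d_def)
      have "pressure_sum X T \<phi> N \<delta> \<le> pressure_sum X T \<phi> (M * n * q) \<delta> * exp (C * real d)"
        unfolding d_def using N M(1) assms(4) C by (intro pressure_sum_mono_length[OF assms(1)])
      also have "\<dots> \<le> exp (real (M * n * q) * r') * exp (C * real d)"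
        using block[of M] by (intro mult_right_mono) (auto simp: M_def)
      also have "\<dots> = exp (real N * r' + real d * (r' + C))"
        unfolding d(1) exp_add[symmetric] by (simp add: algebra_simps)
      also have "\<dots> \<le> exp (real N * r' + D)"
      proof -
        have "real d * (r' + C) \<le> real d * (\<bar>r'\<bar> + C)" by (intro mult_left_mono) auto
        also have "\<dots> \<le> D" unfolding D_def using d(2) C0 by (intro mult_right_mono of_nat_mono) auto
        finally show ?thesis by simp
      qed
      finally have "ln (pressure_sum X T \<phi> N \<delta>) \<le> ln (exp (real N * r' + D))"
        using pressure_sum_antimono(1)[OF assms(1-3) N assms(4) order_refl] by (intro ln_mono)
      then show ?thesis using N by (simp add: field_simps)
    qed
    then have "limsup (\<lambda>N. ereal (1 / real N * ln (pressure_sum X T \<phi> N \<delta>)))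
        \<le> limsup (\<lambda>N. ereal (r' + D / real N))"
      by (intro Limsup_mono eventually_mono[OF eventually_gt_at_top[of 0]]) (simp only: ereal_less_eq)
    also have "(\<lambda>N. r' + D / real N) \<longlonglongrightarrow> r' + 0"
      by (intro tendsto_intros lim_const_over_n)
    then have "limsup (\<lambda>N. ereal (r' + D / real N)) = ereal r'"
      by (intro lim_imp_Limsup) auto
    finally show False using r assms(5) by (simp add: r'_def not_le[symmetric] order.trans)
  qed
  ultimately show ?thesis using that by blast
qed

section \<open>Passage to the limit in the scale\<close>

theorem theorem5p6:
  fixes X :: "'a::metric_space set" and T :: "'a \<Rightarrow> 'a"
    and \<mu> :: "'a measure" and \<phi> :: "'a \<Rightarrow> real"
  assumes "tds X T"
    and "\<mu> \<in> ergodic_measures X T"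
    and "continuous_on X \<phi>"
  shows "((\<lambda>\<epsilon>. liminf (\<lambda>n. ereal (1 / real n * ln (inf_mean_pressure_sum X T \<phi> n \<epsilon>))))
            \<longlongrightarrow> topological_pressure X T \<phi>) (at_right 0)
       \<and> ((\<lambda>\<epsilon>. limsup (\<lambda>n. ereal (1 / real n * ln (inf_mean_pressure_sum X T \<phi> n \<epsilon>))))
            \<longlongrightarrow> topological_pressure X T \<phi>) (at_right 0)"
proof -
  \<comment> \<open>The space of a probability measure is nonempty, and here it is
    \<open>X\<close>.\<close>
  obtain "prob_space \<mu>" "sets \<mu> = sets (restrict_space borel X)"
    using assms(2) by (auto simp: ergodic_measures_def)
  then have ne: "X \<noteq> {}"
    using prob_space.not_empty[of \<mu>] sets_eq_imp_space_eq[of \<mu> "restrict_space borel X"]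
    by (auto simp: space_restrict_space)
  have cpt: "compact X" using assms(1) by (simp add: tds_def)
  obtain C where C: "\<And>x. x \<in> X \<Longrightarrow> \<bar>\<phi> x\<bar> \<le> C"
    using compact_imp_bounded[OF compact_continuous_image[OF assms(3) cpt]]
    by (auto simp: bounded_iff)
  define P where "P = topological_pressure X T \<phi>"
  define f where "f \<epsilon> = limsup (\<lambda>n. ereal (1 / real n * ln (pressure_sum X T \<phi> n \<epsilon>)))" for \<epsilon>
  define g where "g \<epsilon> n = ereal (1 / real n * ln (inf_mean_pressure_sum X T \<phi> n \<epsilon>))" for \<epsilon> n
  have f: "(f \<longlongrightarrow> P) (at_right 0)"
    using topological_pressure_tendsto[OF assms(1,3) ne] by (simp add: f_def[abs_def] P_def)
  have low: "\<forall>\<^sub>F \<epsilon> in at_right 0. a < liminf (g \<epsilon>)" if a: "a < P" for a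
  proof -
    obtain \<delta> where \<delta>: "0 < \<delta>" "a < f \<delta>"
    proof -
      have "\<forall>\<^sub>F \<delta> in at_right 0. a < f \<delta> \<and> 0 < \<delta>"
        using order_tendstoD(1)[OF f a] eventually_at_right_less by (rule eventually_conj)
      then show ?thesis
        using that eventually_happens'[OF trivial_limit_at_right_real] by blast
    qed
    \<comment> \<open>The bounds \<open>a\<close> and \<open>P\<close> may be infinite, so two reals
      are inserted; the loss \<eta> is taken to be \<open>r - s\<close>, which leaves the rate
      \<open>s\<close> for every positive \<open>n\<close>.\<close>
    obtain r where r: "a < ereal r" "ereal r < f \<delta>" using ereal_dense2[OF \<delta>(2)] by blast
    obtain s where s: "a < ereal s" "s < r" using ereal_dense2[OF r(1)] by auto
    obtain \<epsilon>\<^sub>0 where \<epsilon>\<^sub>0: "0 < \<epsilon>\<^sub>0" "\<And>\<epsilon> n. 0 < \<epsilon> \<Longrightarrow> \<epsilon> < \<epsilon>\<^sub>0 \<Longrightarrow> 0 < n \<Longrightarrow>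
        exp (real n * (r - (r - s))) \<le> inf_mean_pressure_sum X T \<phi> n \<epsilon>"
      using exp_le_inf_mean_pressure_sum[OF assms(1,3) ne \<delta>(1), of "r - s" r] r(2) s(2)
      unfolding f_def by auto
    have "a < liminf (g \<epsilon>)" if \<epsilon>: "\<epsilon> \<in> {0<..<\<epsilon>\<^sub>0}" for \<epsilon>
    proof -
      have "ereal s \<le> g \<epsilon> n" if n: "0 < n" for n
      proof -
        have e: "exp (real n * s) \<le> inf_mean_pressure_sum X T \<phi> n \<epsilon>"
          using \<epsilon>\<^sub>0(2)[of \<epsilon> n] \<epsilon> n by simp
        then have "real n * s \<le> ln (inf_mean_pressure_sum X T \<phi> n \<epsilon>)"
          using ln_ge_iff[of "inf_mean_pressure_sum X T \<phi> n \<epsilon>" "real n * s"] less_le_trans[OF exp_gt_zero e]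
          by simp
        then show ?thesis using n by (simp add: g_def field_simps)
      qed
      then have "ereal s \<le> liminf (g \<epsilon>)"
        by (intro Liminf_bounded eventually_mono[OF eventually_gt_at_top[of 0]])
      then show ?thesis using s(1) by simp
    qed
    then show ?thesis using \<epsilon>\<^sub>0(1) by (intro eventually_at_rightI[of 0 \<epsilon>\<^sub>0])
  qed
  have up: "\<forall>\<^sub>F \<epsilon> in at_right 0. limsup (g \<epsilon>) < b" if b: "P < b" for b
  proof -
    obtain e where e: "0 < e" "\<And>\<epsilon>. 0 < \<epsilon> \<Longrightarrow> \<epsilon> < e \<Longrightarrow> f \<epsilon> < b"
      using order_tendstoD(2)[OF f b] by (auto simp: eventually_at_right_field)
    have "limsup (g \<epsilon>) < b" if \<epsilon>: "\<epsilon> \<in> {0<..<e}" for \<epsilon>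
    proof -
      \<comment> \<open>The case \<open>q = 1\<close> compares with \<open>pressure_sum\<close> at
        scale \<open>\<epsilon> / 2\<close>, which still lies below \<open>e\<close>.\<close>
      have "g \<epsilon> n \<le> ereal (1 / real n * ln (pressure_sum X T \<phi> n (\<epsilon> / 2)))" if n: "0 < n" for n
      proof -
        have "0 < inf_mean_pressure_sum X T \<phi> n \<epsilon>"
          using less_le_trans[OF exp_gt_zero inf_mean_pressure_sum_ge[where \<phi> = \<phi>, OF assms(1) ne n _ C]] \<epsilon>
          by simp
        then have "ln (inf_mean_pressure_sum X T \<phi> n \<epsilon>) \<le> ln (pressure_sum X T \<phi> n (\<epsilon> / 2))"
          using inf_mean_pressure_sum_le_pressure_sum[where \<phi> = \<phi>, OF assms(1) ne n _ C] \<epsilon>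
          by (intro ln_mono) auto
        then show ?thesis by (simp add: g_def divide_right_mono)
      qed
      then have "limsup (g \<epsilon>) \<le> f (\<epsilon> / 2)"
        unfolding f_def by (intro Limsup_mono eventually_mono[OF eventually_gt_at_top[of 0]])
      also have "\<dots> < b" using e(2) \<epsilon> by auto
      finally show ?thesis .
    qed
    then show ?thesis using e(1) by (intro eventually_at_rightI[of 0 e])
  qed
  have le: "liminf (g \<epsilon>) \<le> limsup (g \<epsilon>)" for \<epsilon>
    by (intro Liminf_le_Limsup) simp
  have "((\<lambda>\<epsilon>. liminf (g \<epsilon>)) \<longlongrightarrow> P) (at_right 0)"
  proof (rule order_tendstoI)
    show "\<forall>\<^sub>F \<epsilon> in at_right 0. liminf (g \<epsilon>) < b" if "P < b" for b
      using up[OF that] by eventually_elim (use le le_less_trans in blast)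
  qed (rule low)
  moreover have "((\<lambda>\<epsilon>. limsup (g \<epsilon>)) \<longlongrightarrow> P) (at_right 0)"
  proof (rule order_tendstoI)
    show "\<forall>\<^sub>F \<epsilon> in at_right 0. a < limsup (g \<epsilon>)" if "a < P" for a
      using low[OF that] by eventually_elim (use le less_le_trans in blast)
  qed (rule up)
  ultimately show ?thesis by (simp only: P_def g_def[abs_def])
qed

end
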